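(* For each integer $k\ge 1$ let $A_k$ denote the tridiagonal $k\times k$ matrix with $1$s just above and just below the main diagonal and $0$s elsewhere (so $(A_k)_{i,j}=1$ if $|i-j|=1$ and $(A_k)_{i,j}=0$ otherwise), and let $S_k(x)$ denote the sum of all the entries of $(I_k-xA_k)^{-1}$, where $I_k$ is the $k\times k$ identity matrix; set $S_0(x)=0$. Then: (i) for every integer $k\ge 2$, the generating function $\sum_{n\ge 0} b_k(n)x^n$, where $b_k(n)$ is the number of bad walks of length $n$ on the circular digraph $C_k$, equals $$S_{k-1}(x)-S_{k-2}(x);$$ (ii) in other words, for every integer $k\ge 0$, the generating function $f_k(x)=\sum_{n\ge 0} a_k(n)x^n$, where $a_k(n)$ is the number of $k$-balanced binary strings of length $n$, equals $$f_k(x)=S_{k+1}(x)-S_k(x).$$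
   Context: Generating functions are formal power series in $x$ (equivalently, the identities are between rational functions in $x$ expanded at $x=0$). The circular digraph $C_k$ has $k$ nodes $v_0,\dots,v_{k-1}$, with an arc from $v_i$ to $v_{(i+1) \bmod k}$ and an arc from $v_{(i+1)\bmod k}$ to $v_i$ for each $i=0,\dots,k-1$. A walk of length $n$ on $C_k$ is a sequence of $n+1$ nodes $(w_0,\dots,w_n)$ such that $w_i$ is adjacent to $w_{i+1}$ in $C_k$ for $0\le i\le n-1$. A bad walk on $C_k$ is a walk with $w_0=v_0$ that does not visit all $k$ nodes of $C_k$. For a finite binary string $T$, $\Delta(T)$ denotes the number of $1$'s in $T$ minus the number of $0$'s in $T$. A finite binary string $S$ (possibly empty) is $k$-balanced if every substring $T$ of consecutive bits of $S$ satisfies $-k\le \Delta(T)\le k$. *)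

theory Defs
  imports
    "HOL-Library.Sublist"
    "HOL-Computational_Algebra.Formal_Power_Series"
    "Jordan_Normal_Form.Determinant"
    "Graph_Theory.Vertex_Walk"
begin

definition tridiag_mat :: "nat \<Rightarrow> 'a :: {zero, one} mat" where
  "tridiag_mat k = mat k k (\<lambda>(i, j). if \<bar>int i - int j\<bar> = 1 then 1 else 0)"

definition resolvent_arg :: "nat \<Rightarrow> rat fps mat" where
  "resolvent_arg k = 1\<^sub>m k - fps_X \<cdot>\<^sub>m tridiag_mat k"

(* The matrix inverse is the inverse in the matrix ring over the formal power
   series; it exists by resolvent_arg_Units below. *)
definition S_series :: "nat \<Rightarrow> rat fps" where
  "S_series k = (if k = 0 then 0
          else sum_mat (inv\<^bsub>ring_mat TYPE(rat fps) k ()\<^esub> (resolvent_arg k)))"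

lemma resolvent_arg_Units:
  "resolvent_arg k \<in> Units (ring_mat TYPE(rat fps) k ())"
proof -
  let ?M = "resolvent_arg k"
  interpret h: comm_ring_hom "\<lambda>f :: rat fps. fps_nth f 0"
    by unfold_locales auto
  have M: "?M \<in> carrier_mat k k"
    by (auto simp: resolvent_arg_def tridiag_mat_def)
  have "map_mat (\<lambda>f. fps_nth f 0) ?M = 1\<^sub>m k"
    by (rule eq_matI) (auto simp: resolvent_arg_def tridiag_mat_def)
  then have "fps_nth (det ?M) 0 = 1"
    using h.hom_det[of ?M] by simp
  then have d: "inverse (det ?M) * det ?M = 1"
    by (intro inverse_mult_eq_1) simp
  define B where "B = inverse (det ?M) \<cdot>\<^sub>m adj_mat ?M"
  have B: "B \<in> carrier_mat k k"
    using adj_mat(1)[OF M] by (simp add: B_def)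
  have one: "inverse (det ?M) \<cdot>\<^sub>m (det ?M \<cdot>\<^sub>m 1\<^sub>m k) = 1\<^sub>m k"
    using d by (intro eq_matI) (auto simp: mult.assoc[symmetric])
  have "?M * B = 1\<^sub>m k"
    using mult_smult_distrib[OF M adj_mat(1)[OF M]] adj_mat(2)[OF M] one
    by (simp add: B_def)
  moreover have "B * ?M = 1\<^sub>m k"
    using mult_smult_assoc_mat[OF adj_mat(1)[OF M] M] adj_mat(3)[OF M] one
    by (simp add: B_def)
  ultimately show ?thesis
    using M B by (auto simp: Units_def ring_mat_def)
qed

(* Arcs are pairs of nodes, so the coinciding arcs for k = 2 are identified;
   this does not affect walks, which are sequences of nodes. *)
definition circ_digraph :: "nat \<Rightarrow> (nat, nat \<times> nat) pre_digraph" where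
  "circ_digraph k =
    \<lparr> verts = {..<k},
      arcs = (\<Union>i<k. {(i, (i + 1) mod k), ((i + 1) mod k, i)}),
      tail = fst,
      head = snd \<rparr>"

definition bad_walk :: "nat \<Rightarrow> nat vwalk \<Rightarrow> bool" where
  "bad_walk k w \<longleftrightarrow>
    vwalk w (circ_digraph k) \<and> hd w = 0 \<and> \<not> verts (circ_digraph k) \<subseteq> set w"

definition num_bad_walks :: "nat \<Rightarrow> nat \<Rightarrow> nat" where
  "num_bad_walks k n = card {w. bad_walk k w \<and> vwalk_length w = n}"

(* The bit 1 is True and the bit 0 is False. *)
definition Delta :: "bool list \<Rightarrow> int" where
  "Delta T = int (count_list T True) - int (count_list T False)"

definition balanced :: "nat \<Rightarrow> bool list \<Rightarrow> bool" where
  "balanced k s \<longleftrightarrow> (\<forall>T. sublist T s \<longrightarrow> - int k \<le> Delta T \<and> Delta T \<le> int k)"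

definition num_balanced :: "nat \<Rightarrow> nat \<Rightarrow> nat" where
  "num_balanced k n = card {s. balanced k s \<and> length s = n}"

end

theory Submission
  imports Defs
begin

text \<open>
  Read a binary string as a \<open>\<plusminus>1\<close> lattice path on the integers and let \<open>R\<close> be the maximum minus the
  minimum of its partial sums. The string is \<open>k\<close>-balanced iff \<open>R \<le> k\<close>, and exactly
  \<open>max 0 (k - R)\<close> starting points keep its path inside a strip of \<open>k\<close> consecutive integers.
  The row sums of the resolvent satisfy the first-step recursion for the number of confined paths
  from a given start, so the coefficient of \<open>x^n\<close> in \<open>S\<^sub>k\<close> is the sum of \<open>max 0 (k - R)\<close> over
  all strings of length \<open>n\<close>; the difference \<open>S\<^sub>k\<^sub>+\<^sub>1 - S\<^sub>k\<close> therefore counts those with \<open>R \<le> k\<close>.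
  A walk on the circular digraph from node 0 lifts to a lattice path, and it misses a node iff
  \<open>R \<le> k - 2\<close>. The lift is unique for \<open>k \<ge> 3\<close>; for \<open>k = 2\<close> both steps coincide modulo \<open>k\<close>, but
  then only the empty string gives a bad walk.
\<close>

section \<open>Lattice paths of binary strings\<close>

definition bit_step :: "bool \<Rightarrow> int" where
  "bit_step b = (if b then 1 else - 1)"

primrec path :: "int \<Rightarrow> bool list \<Rightarrow> int list" where
  "path z [] = [z]"
| "path z (b # s) = z # path (z + bit_step b) s"

text \<open>The empty prefix counts as the partial sum 0, so
  \<open>path_min s \<le> 0 \<le> path_max s\<close>.\<close>

primrec path_max :: "bool list \<Rightarrow> int" where
  "path_max [] = 0"
| "path_max (b # s) = max 0 (bit_step b + path_max s)"

primrec path_min :: "bool list \<Rightarrow> int" where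
  "path_min [] = 0"
| "path_min (b # s) = min 0 (bit_step b + path_min s)"

lemma path_max_nonneg: "0 \<le> path_max s"
  by (cases s) auto

lemma path_min_nonpos: "path_min s \<le> 0"
  by (cases s) auto

lemma length_path [simp]: "length (path z s) = Suc (length s)"
  by (induction s arbitrary: z) auto

lemma path_nonempty [simp]: "path z s \<noteq> []"
  by (cases s) auto

lemma hd_path [simp]: "hd (path z s) = z"
  by (cases s) auto

text \<open>Steps have size 1, so no integer between the extremes is skipped.\<close>

lemma set_path: "set (path z s) = {z + path_min s..z + path_max s}"
proof (induction s arbitrary: z)
  case (Cons b s)
  show ?case
    using path_max_nonneg[of s] path_min_nonpos[of s]
    by (auto simp: Cons bit_step_def)
qed auto

section \<open>Balance and the range of the partial sums\<close>

lemma Delta_Nil [simp]: "Delta [] = 0"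
  by (simp add: Delta_def)

lemma Delta_Cons [simp]: "Delta (b # s) = bit_step b + Delta s"
  by (simp add: Delta_def bit_step_def)

lemma all_prefix_Cons:
  "(\<forall>T. prefix T (b # s) \<longrightarrow> P T) \<longleftrightarrow> P [] \<and> (\<forall>T. prefix T s \<longrightarrow> P (b # T))"
  by (auto simp: prefix_Cons)

text \<open>\<open>Delta T\<close> is the height reached after the prefix \<open>T\<close>. Dropping
  the first bit shifts all heights, so \<open>m\<close> must vary in the induction.\<close>

lemma Delta_prefix_le_iff: "(\<forall>T. prefix T s \<longrightarrow> Delta T \<le> m) \<longleftrightarrow> path_max s \<le> m"
proof (induction s arbitrary: m)
  case (Cons b s)
  show ?case
    using Cons[of "m - bit_step b"] by (simp add: all_prefix_Cons le_diff_eq add.commute)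
qed simp

lemma Delta_prefix_ge_iff: "(\<forall>T. prefix T s \<longrightarrow> m \<le> Delta T) \<longleftrightarrow> m \<le> path_min s"
proof (induction s arbitrary: m)
  case (Cons b s)
  show ?case
    using Cons[of "m - bit_step b"] by (simp add: all_prefix_Cons diff_le_eq add.commute)
qed simp

text \<open>Substrings of \<open>b # s\<close> are its prefixes, controlled by the extremes, and the
  substrings of \<open>s\<close>, controlled by induction.\<close>

lemma balanced_iff: "balanced k s \<longleftrightarrow> path_max s - path_min s \<le> int k"
proof (induction s)
  case Nil
  show ?case by (simp add: balanced_def)
next
  case (Cons b s)
  have "balanced k (b # s) \<longleftrightarrow>
      (\<forall>T. prefix T (b # s) \<longrightarrow> - int k \<le> Delta T) \<and>
      (\<forall>T. prefix T (b # s) \<longrightarrow> Delta T \<le> int k) \<and> balanced k s"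
    unfolding balanced_def sublist_Cons_right by blast
  also have "\<dots> \<longleftrightarrow> - int k \<le> path_min (b # s) \<and> path_max (b # s) \<le> int k \<and>
      path_max s - path_min s \<le> int k"
    by (simp only: Delta_prefix_le_iff Delta_prefix_ge_iff Cons)
  \<comment> \<open>The range of \<open>b # s\<close> is the largest of
    \<open>path_max (b # s)\<close>, \<open>- path_min (b # s)\<close> and the range of
    \<open>s\<close>.\<close>
  also have "\<dots> \<longleftrightarrow> path_max (b # s) - path_min (b # s) \<le> int k"
    using path_max_nonneg[of s] path_min_nonpos[of s] by auto
  finally show ?case .
qed

lemma finite_bool_lists [simp]: "finite {s :: bool list. length s = n \<and> P s}"
  using finite_lists_length_eq[of "UNIV :: bool set" n]
  by (rule rev_finite_subset) auto


section \<open>Counting paths confined to a strip\<close>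

text \<open>\<open>z\<close> is an integer rather than a row index, so that both neighbours of a
  boundary point make sense; outside the strip the count is 0.\<close>

definition strip_count :: "nat \<Rightarrow> int \<Rightarrow> nat \<Rightarrow> nat" where
  "strip_count k z n = card {s. length s = n \<and> set (path z s) \<subseteq> {0..<int k}}"

lemma strip_count_outside: "z \<notin> {0..<int k} \<Longrightarrow> strip_count k z n = 0"
proof -
  assume "z \<notin> {0..<int k}"
  then have "\<not> set (path z s) \<subseteq> {0..<int k}" for s
    by (metis hd_in_set hd_path path_nonempty subsetD)
  then show ?thesis by (simp add: strip_count_def)
qed

lemma strip_count_0: "z \<in> {0..<int k} \<Longrightarrow> strip_count k z 0 = 1"
proof -
  assume "z \<in> {0..<int k}"
  then have "{s. length s = 0 \<and> set (path z s) \<subseteq> {0..<int k}} = {[]}"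
    by auto
  then show ?thesis by (simp only: strip_count_def) simp
qed

text \<open>The first bit decides where the rest of the path starts. For \<open>z\<close> outside
  the strip the left side is 0 while the right side may be positive.\<close>

lemma strip_count_Suc:
  assumes "z \<in> {0..<int k}"
  shows "strip_count k z (Suc n) = strip_count k (z + 1) n + strip_count k (z - 1) n"
proof -
  let ?A = "\<lambda>z n. {s. length s = n \<and> set (path z s) \<subseteq> {0..<int k}}"
  have "s \<in> ?A z (Suc n) \<longleftrightarrow> s \<in> Cons True ` ?A (z + 1) n \<union> Cons False ` ?A (z - 1) n" for s
    using assms by (cases s; cases "hd s") (auto simp: bit_step_def)
  then have "?A z (Suc n) = Cons True ` ?A (z + 1) n \<union> Cons False ` ?A (z - 1) n"
    by blast
  moreover have "card (Cons True ` ?A (z + 1) n \<union> Cons False ` ?A (z - 1) n) =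
      card (?A (z + 1) n) + card (?A (z - 1) n)"
    by (subst card_Un_disjoint) (auto simp: card_image)
  ultimately show ?thesis
    by (simp only: strip_count_def)
qed

lemma set_path_subset_iff:
  "set (path z s) \<subseteq> {0..<int k} \<longleftrightarrow> 0 \<le> z + path_min s \<and> z + path_max s < int k"
proof -
  have "z + path_min s \<in> set (path z s)" "z + path_max s \<in> set (path z s)"
    using path_max_nonneg[of s] path_min_nonpos[of s] by (auto simp: set_path)
  moreover have "z + path_min s \<le> y" "y \<le> z + path_max s" if "y \<in> set (path z s)" for y
    using that by (auto simp: set_path)
  ultimately show ?thesis
    by fastforce
qed

text \<open>The admissible starts run from \<open>- path_min s\<close> to just below
  \<open>int k - path_max s\<close>; \<open>nat\<close> yields 0 when there are none.\<close>

lemma card_starts: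
  "card {i. i < k \<and> set (path (int i) s) \<subseteq> {0..<int k}} = nat (int k - (path_max s - path_min s))"
proof -
  have "{i. i < k \<and> set (path (int i) s) \<subseteq> {0..<int k}} = {nat (- path_min s)..<nat (int k - path_max s)}"
    using path_max_nonneg[of s] path_min_nonpos[of s] by (auto simp: set_path_subset_iff)
  then show ?thesis
    using path_max_nonneg[of s] path_min_nonpos[of s] by simp
qed

text \<open>Double counting of the pairs of a start and a string.\<close>

lemma sum_strip_count:
  "(\<Sum>i<k. strip_count k (int i) n) =
    (\<Sum>s | length s = n. nat (int k - (path_max s - path_min s)))"
proof -
  let ?P = "\<lambda>i s. set (path (int i) s) \<subseteq> {0..<int k}"
  have fin: "finite {s :: bool list. length s = n}"
    using finite_bool_lists[of n "\<lambda>_. True"] by simp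
  have "(\<Sum>i<k. strip_count k (int i) n) = (\<Sum>i<k. \<Sum>s | length s = n. of_bool (?P i s))"
    using fin by (intro sum.cong refl) (simp add: strip_count_def Int_def)
  also have "\<dots> = (\<Sum>s | length s = n. \<Sum>i<k. of_bool (?P i s))"
    by (rule sum.swap)
  also have "\<dots> = (\<Sum>s | length s = n. nat (int k - (path_max s - path_min s)))"
    by (intro sum.cong refl) (simp add: card_starts[symmetric] Int_def)
  finally show ?thesis .
qed

lemma sum_strip_count_Suc:
  "(\<Sum>i<Suc k. strip_count (Suc k) (int i) n) =
    (\<Sum>i<k. strip_count k (int i) n) + num_balanced k n"
proof -
  have fin: "finite {s :: bool list. length s = n}"
    using finite_bool_lists[of n "\<lambda>_. True"] by simp
  \<comment> \<open>Widening the strip by one adds one start if the range is at most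
    \<open>k\<close>; otherwise both truncated differences are 0.\<close>
  have "nat (int (Suc k) - (path_max s - path_min s)) =
      nat (int k - (path_max s - path_min s)) + of_bool (balanced k s)" for s
    by (auto simp: balanced_iff)
  then have "(\<Sum>i<Suc k. strip_count (Suc k) (int i) n) = (\<Sum>i<k. strip_count k (int i) n) +
      (\<Sum>s | length s = n. of_bool (balanced k s))"
    by (simp only: sum_strip_count sum.distrib)
  also have "(\<Sum>s | length s = n. of_bool (balanced k s)) = num_balanced k n"
    using fin by (simp add: num_balanced_def Int_def conj_commute)
  finally show ?thesis .
qed


section \<open>The resolvent of the tridiagonal matrix\<close>

text \<open>This is row \<open>i\<close> of the tridiagonal matrix applied to \<open>f\<close>;
  since \<open>f\<close> vanishes outside, the first and last rows look like the others.\<close>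

lemma sum_neighbours:
  fixes f :: "int \<Rightarrow> 'a :: comm_monoid_add"
  assumes "i < k" and outside: "\<And>z. z \<notin> {0..<int k} \<Longrightarrow> f z = 0"
  shows "(\<Sum>j<k. if \<bar>int i - int j\<bar> = 1 then f (int j) else 0) = f (int i + 1) + f (int i - 1)"
proof -
  have nb: "(\<Sum>j<k. if int j = z then f (int j) else 0) = f z" for z
  proof (cases "z \<in> {0..<int k}")
    case True
    then have "(\<Sum>j<k. if int j = z then f (int j) else 0) = (\<Sum>j<k. if j = nat z then f z else 0)"
      by (intro sum.cong) auto
    with True show ?thesis by (simp add: nat_less_iff)
  next
    case False
    then show ?thesis using outside by (auto intro!: sum.neutral)
  qed
  have "(\<Sum>j<k. if \<bar>int i - int j\<bar> = 1 then f (int j) else 0) =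
      (\<Sum>j<k. (if int j = int i + 1 then f (int j) else 0) + (if int j = int i - 1 then f (int j) else 0))"
    by (intro sum.cong) auto
  then show ?thesis
    by (simp only: sum.distrib nb)
qed

section \<open>Generating functions of the strip counts\<close>

definition strip_series :: "nat \<Rightarrow> int \<Rightarrow> rat fps" where
  "strip_series k z = Abs_fps (\<lambda>n. of_nat (strip_count k z n))"

text \<open>First-step recursion for power series; the constant 1 is the empty string.\<close>

lemma strip_series_eq:
  assumes "z \<in> {0..<int k}"
  shows "strip_series k z - fps_X * (strip_series k (z + 1) + strip_series k (z - 1)) = 1"
proof (rule fps_ext)
  fix n
  show "fps_nth (strip_series k z - fps_X * (strip_series k (z + 1) + strip_series k (z - 1))) n =
      fps_nth 1 n"
    using assms by (cases n) (simp_all add: strip_series_def strip_count_0 strip_count_Suc)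
qed

lemma strip_series_outside: "z \<notin> {0..<int k} \<Longrightarrow> strip_series k z = 0"
  by (rule fps_ext) (simp add: strip_series_def strip_count_outside)

lemma resolvent_arg_carrier: "resolvent_arg k \<in> carrier_mat k k"
  by (auto simp: resolvent_arg_def tridiag_mat_def)

text \<open>Applying the inverse turns the right side into its vector of row sums, which are thus
  the strip series.\<close>

lemma resolvent_arg_mult_strip_series:
  "resolvent_arg k *\<^sub>v vec k (\<lambda>i. strip_series k (int i)) = vec k (\<lambda>_. 1)"
proof (rule eq_vecI)
  fix i
  assume "i < dim_vec (vec k (\<lambda>_. 1 :: rat fps))"
  then have i: "i < k" by simp
  let ?w = "\<lambda>j. strip_series k (int j)"
  let ?a = "\<lambda>j. if \<bar>int i - int j\<bar> = 1 then strip_series k (int j) else 0"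
  have "(resolvent_arg k *\<^sub>v vec k ?w) $ i = (\<Sum>j<k. (if i = j then ?w j else 0) - fps_X * ?a j)"
    using i resolvent_arg_carrier[of k]
    by (auto simp: scalar_prod_def resolvent_arg_def tridiag_mat_def lessThan_atLeast0
        algebra_simps intro!: sum.cong)
  also have "\<dots> = ?w i - fps_X * (\<Sum>j<k. ?a j)"
    using i by (simp add: sum_subtractf sum_distrib_left)
  also have "\<dots> = ?w i - fps_X * (strip_series k (int i + 1) + strip_series k (int i - 1))"
    using i strip_series_outside by (subst sum_neighbours) auto
  also have "\<dots> = 1"
    using i by (intro strip_series_eq) auto
  finally show "(resolvent_arg k *\<^sub>v vec k ?w) $ i = vec k (\<lambda>_. 1) $ i"
    using i by simp
qed (use resolvent_arg_carrier[of k] in auto)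

lemma S_series_eq: "S_series k = (\<Sum>i<k. strip_series k (int i))"
proof (cases "k = 0")
  case False
  let ?R = "ring_mat TYPE(rat fps) k ()"
  define B where "B = inv\<^bsub>?R\<^esub> (resolvent_arg k)"
  interpret R: ring ?R by (rule ring_mat)
  have B: "B \<in> carrier_mat k k"
    using R.Units_inv_closed[OF resolvent_arg_Units] by (simp add: B_def ring_mat_simps)
  have BM: "B * resolvent_arg k = 1\<^sub>m k"
    using R.Units_l_inv[OF resolvent_arg_Units] by (simp add: B_def ring_mat_simps)
  let ?w = "vec k (\<lambda>i. strip_series k (int i))"
  have "?w = (B * resolvent_arg k) *\<^sub>v ?w"
    by (simp add: BM)
  also have "\<dots> = B *\<^sub>v vec k (\<lambda>_. 1)"
    using B resolvent_arg_carrier[of k]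
    by (simp add: assoc_mult_mat_vec[of _ k k _ k] resolvent_arg_mult_strip_series)
  finally have w: "?w = B *\<^sub>v vec k (\<lambda>_. 1)" .
  have row: "strip_series k (int i) = (\<Sum>j<k. B $$ (i, j))" if "i < k" for i
    using arg_cong[OF w, of "\<lambda>v. v $ i"] that B
    by (simp add: scalar_prod_def lessThan_atLeast0)
  have "S_series k = (\<Sum>i<k. \<Sum>j<k. B $$ (i, j))"
    using False B by (simp add: S_series_def B_def[symmetric] sum_mat_def
        sum.cartesian_product lessThan_atLeast0)
  then show ?thesis
    by (simp add: row)
qed (simp add: S_series_def)

lemma num_balanced_series:
  "Abs_fps (\<lambda>n. of_nat (num_balanced k n)) = S_series (k + 1) - S_series k"
proof (rule fps_ext)
  fix n
  have S: "fps_nth (S_series k) n = of_nat (\<Sum>i<k. strip_count k (int i) n)" for k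
    by (simp add: S_series_eq fps_sum_nth strip_series_def)
  show "fps_nth (Abs_fps (\<lambda>n. of_nat (num_balanced k n))) n =
      fps_nth (S_series (k + 1) - S_series k) n"
    unfolding fps_sub_nth S Suc_eq_plus1[symmetric] sum_strip_count_Suc by simp
qed


section \<open>Unrolling walks on the circular digraph\<close>

text \<open>The covering map from the integer line to the cycle.\<close>

definition cyc :: "nat \<Rightarrow> int \<Rightarrow> nat" where
  "cyc k z = nat (z mod int k)"

lemma cyc_less: "0 < k \<Longrightarrow> cyc k z < k"
  by (simp add: cyc_def nat_less_iff)

lemma cyc_eq_iff: "0 < k \<Longrightarrow> cyc k z = v \<longleftrightarrow> v < k \<and> int k dvd z - int v"
  unfolding mod_eq_dvd_iff[symmetric]
  by (metis cyc_def cyc_less mod_less nat_int of_nat_0_less_iff pos_mod_sign nat_0_le zmod_int)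

lemma cyc_eq_cyc_iff: "0 < k \<Longrightarrow> cyc k y = cyc k z \<longleftrightarrow> int k dvd y - z"
  by (auto simp: cyc_def mod_eq_dvd_iff[symmetric] eq_nat_nat_iff)

lemma arcs_ends_circ_digraph:
  assumes "0 < k"
  shows "(u, v) \<in> arcs_ends (circ_digraph k) \<longleftrightarrow>
    u < k \<and> v < k \<and> (v = (u + 1) mod k \<or> u = (v + 1) mod k)"
  using assms by (auto simp: arcs_ends_conv circ_digraph_def image_iff)

text \<open>Arcs lift to unit steps from any chosen preimage \<open>z\<close>. The bit
  \<open>b\<close> is not unique when \<open>k \<le> 2\<close>, as both steps then agree modulo
  \<open>k\<close>.\<close>

lemma arc_from_cyc_iff:
  assumes "0 < k"
  shows "(cyc k z, v) \<in> arcs_ends (circ_digraph k) \<longleftrightarrow> (\<exists>b. v = cyc k (z + bit_step b))"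
proof -
  have c: "Suc w mod k = cyc k (int w + 1)" for w
    by (simp add: cyc_def nat_mod_distrib nat_add_distrib algebra_simps)
  have 1: "v = (cyc k z + 1) mod k \<longleftrightarrow> v = cyc k (z + 1)"
  proof -
    have "cyc k (int (cyc k z) + 1) = cyc k (z + 1)"
      using assms by (simp add: cyc_def mod_add_left_eq)
    then show ?thesis by (simp add: c)
  qed
  \<comment> \<open>The successor fixes \<open>v\<close> only modulo \<open>k\<close>;
    \<open>v < k\<close> selects the canonical residue.\<close>
  have 2: "v < k \<and> cyc k z = (v + 1) mod k \<longleftrightarrow> v = cyc k (z - 1)"
    using assms cyc_less[OF assms] cyc_eq_iff[OF assms, of "z - 1" v]
    by (auto simp: c cyc_eq_cyc_iff algebra_simps)
  have "(cyc k z, v) \<in> arcs_ends (circ_digraph k) \<longleftrightarrow> v = cyc k (z + 1) \<or> v = cyc k (z - 1)"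
    using 1 2 cyc_less[OF assms] by (auto simp: arcs_ends_circ_digraph[OF assms])
  then show ?thesis
    by (auto simp: bit_step_def ex_bool_eq)
qed

lemma vwalk_Cons_Cons:
  "vwalk (u # v # w) G \<longleftrightarrow> u \<in> verts G \<and> (u, v) \<in> arcs_ends G \<and> vwalk (v # w) G"
  by (auto simp: vwalk_def)

text \<open>Walk lifting, one arc at a time; the preimage \<open>z\<close> moves along with the
  walk.\<close>

lemma vwalk_circ_digraph_iff:
  assumes "0 < k"
  shows "vwalk w (circ_digraph k) \<and> hd w = cyc k z \<longleftrightarrow> (\<exists>s. w = map (cyc k) (path z s))"
proof
  assume "vwalk w (circ_digraph k) \<and> hd w = cyc k z"
  then show "\<exists>s. w = map (cyc k) (path z s)"
  proof (induction w arbitrary: z)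
    case Nil
    then show ?case by (simp add: vwalk_def)
  next
    case (Cons u w)
    show ?case
    proof (cases w)
      case Nil
      with Cons.prems have "u # w = map (cyc k) (path z [])" by simp
      then show ?thesis by (rule exI)
    next
      case w: (Cons v w')
      with Cons.prems have "(cyc k z, v) \<in> arcs_ends (circ_digraph k)"
        by (auto simp: vwalk_Cons_Cons)
      then obtain b where v: "v = cyc k (z + bit_step b)"
        using arc_from_cyc_iff[OF assms] by blast
      with Cons.prems w have "vwalk w (circ_digraph k) \<and> hd w = cyc k (z + bit_step b)"
        by (simp add: vwalk_Cons_Cons)
      then obtain s where "w = map (cyc k) (path (z + bit_step b) s)"
        using Cons.IH by blast
      with Cons.prems have "u # w = map (cyc k) (path z (b # s))" by simp
      then show ?thesis by (rule exI)
    qed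
  qed
next
  have "vwalk (map (cyc k) (path z s)) (circ_digraph k)" for s
  proof (induction s arbitrary: z)
    case Nil
    show ?case
      using cyc_less[OF assms] by (auto simp: vwalk_def circ_digraph_def)
  next
    case (Cons b s)
    obtain p where p: "path (z + bit_step b) s = (z + bit_step b) # p"
      by (cases s) auto
    have "(cyc k z, cyc k (z + bit_step b)) \<in> arcs_ends (circ_digraph k)"
      using arc_from_cyc_iff[OF assms] by blast
    then show ?case
      using Cons[of "z + bit_step b"] cyc_less[OF assms]
      by (auto simp: p vwalk_Cons_Cons circ_digraph_def)
  qed
  then show "\<exists>s. w = map (cyc k) (path z s) \<Longrightarrow> vwalk w (circ_digraph k) \<and> hd w = cyc k z"
    by (auto simp: hd_map)
qed

lemma cyc_interval_covers_iff:
  assumes "0 < k" "m \<le> M"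
  shows "{..<k} \<subseteq> cyc k ` {m..M} \<longleftrightarrow> int k \<le> M - m + 1"
proof
  assume "{..<k} \<subseteq> cyc k ` {m..M}"
  then have "card {..<k} \<le> card (cyc k ` {m..M})"
    by (intro card_mono) auto
  also have "\<dots> \<le> card {m..M}"
    by (rule card_image_le) simp
  finally show "int k \<le> M - m + 1" using assms by simp
next
  assume le: "int k \<le> M - m + 1"
  show "{..<k} \<subseteq> cyc k ` {m..M}"
  proof
    fix v assume v: "v \<in> {..<k}"
    \<comment> \<open>The least integer from \<open>m\<close> on that is congruent to
      \<open>v\<close> modulo \<open>k\<close>; it is at most \<open>m + k - 1\<close>.\<close>
    let ?z = "m + (int v - m) mod int k"
    have "?z \<in> {m..M}"
      using le assms(1) pos_mod_bound[of "int k" "int v - m"] pos_mod_sign[of "int k" "int v - m"]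
      unfolding atLeastAtMost_iff by linarith
    moreover have "v = cyc k ?z"
      using v by (simp add: cyc_def mod_add_right_eq)
    ultimately show "v \<in> cyc k ` {m..M}" by blast
  qed
qed

text \<open>Different bits give endpoints that differ by 2, which no \<open>k \<ge> 3\<close>
  divides.\<close>

lemma map_cyc_path_inj:
  assumes "3 \<le> k" "map (cyc k) (path z s) = map (cyc k) (path z t)"
  shows "s = t"
  using assms(2)
proof (induction s arbitrary: z t)
  case Nil
  then show ?case by (cases t) auto
next
  case (Cons b s)
  then obtain c t' where t: "t = c # t'"
    by (cases t) auto
  have eq: "map (cyc k) (path (z + bit_step b) s) = map (cyc k) (path (z + bit_step c) t')"
    using Cons.prems t by simp
  then have "cyc k (z + bit_step b) = cyc k (z + bit_step c)"
    by (metis hd_map hd_path path_nonempty)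
  then have "int k dvd bit_step b - bit_step c"
    using assms(1) by (simp add: cyc_eq_cyc_iff)
  then have "b = c"
    using assms(1) zdvd_not_zless[of 2 "int k"] by (auto simp: bit_step_def split: if_splits)
  with eq t Cons.IH show ?case by blast
qed

section \<open>Bad walks as images of balanced strings\<close>

lemma balanced_0_iff: "balanced 0 s \<longleftrightarrow> s = []"
proof (cases s)
  case (Cons b s')
  then show ?thesis
    using path_max_nonneg[of s'] path_min_nonpos[of s'] by (auto simp: balanced_iff bit_step_def)
qed (simp add: balanced_iff)

lemma num_bad_walks_eq_num_balanced:
  assumes "2 \<le> k"
  shows "num_bad_walks k n = num_balanced (k - 2) n"
proof -
  have k: "0 < k" using assms by simp
  \<comment> \<open>A path of range \<open>R\<close> visits \<open>R + 1\<close> consecutive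
    integers, so a node is missed iff \<open>R + 1 < k\<close>.\<close>
  have covers: "verts (circ_digraph k) \<subseteq> set (map (cyc k) (path 0 s)) \<longleftrightarrow> \<not> balanced (k - 2) s" for s
    using cyc_interval_covers_iff[OF k, of "path_min s" "path_max s"]
      path_max_nonneg[of s] path_min_nonpos[of s] assms
    by (auto simp: circ_digraph_def set_path balanced_iff)
  have bad: "bad_walk k w \<longleftrightarrow> (\<exists>s. w = map (cyc k) (path 0 s) \<and> balanced (k - 2) s)" for w
  proof -
    have "cyc k 0 = 0" by (simp add: cyc_def)
    then show ?thesis
      using vwalk_circ_digraph_iff[OF k, of w 0] covers unfolding bad_walk_def by metis
  qed
  have "{w. bad_walk k w \<and> vwalk_length w = n} =
      (\<lambda>s. map (cyc k) (path 0 s)) ` {s. balanced (k - 2) s \<and> length s = n}"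
    by (auto simp: bad)
  moreover have "inj_on (\<lambda>s. map (cyc k) (path 0 s)) {s. balanced (k - 2) s \<and> length s = n}"
  \<comment> \<open>Lifts are not unique for \<open>k = 2\<close>, but only the empty string is
    0-balanced.\<close>
  proof (cases "k = 2")
    case True
    then show ?thesis by (auto simp: balanced_0_iff inj_on_def)
  next
    case False
    with assms show ?thesis
      by (auto intro!: inj_onI map_cyc_path_inj[of k 0])
  qed
  ultimately show ?thesis
    by (simp add: num_bad_walks_def num_balanced_def card_image)
qed

theorem theorem1:
  shows "(\<forall>k\<ge>2. Abs_fps (\<lambda>n. of_nat (num_bad_walks k n)) = S_series (k - 1) - S_series (k - 2)) \<and>
    (\<forall>k. Abs_fps (\<lambda>n. of_nat (num_balanced k n)) = S_series (k + 1) - S_series k)"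
proof (intro conjI allI impI)
  fix k :: nat
  assume "2 \<le> k"
  then show "Abs_fps (\<lambda>n. of_nat (num_bad_walks k n)) = S_series (k - 1) - S_series (k - 2)"
    using num_balanced_series[of "k - 2"]
    by (simp add: num_bad_walks_eq_num_balanced Suc_diff_Suc numeral_2_eq_2)
qed (rule num_balanced_series)

end
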